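(* Let $i,m\in\mathbb{N}$ with $i\ge1$, let $v\in\mathbb{R}^i$ and $\omega_0\in\mathbb{R}^n$. Then either there exists $k_0\ge i$ such that $CB^mQ_i^k(v)\omega_0\neq0$ for all $k\ge k_0$, or $CB^mQ_i^k(v)\omega_0=0$ for all $k\ge i$.
   Context: Let $n\ge1$, $A,B\in\mathrm{End}(\mathbb{R}^n)$, $C\in\mathcal{L}(\mathbb{R}^n,\mathbb{R})$. Polynomials have commuting scalar indeterminates $X_0,X_1,\dots$ and coefficients in $\mathrm{End}(\mathbb{R}^n)$. Define the linear map $\Psi$ by $\Psi(P)(X_0,\dots,X_k)=P(X_0,\dots,X_{k-1})(A+X_0B)+\sum_{i=0}^{k-1}\frac{\partial P}{\partial X_i}(X_0,\dots,X_{k-1})X_{i+1}$, where $k$ is the least $\ell$ such that $P$ involves only $X_0,\dots,X_{\ell-1}$. Let $P_0=I$, $P_{k+1}=\Psi(P_k)$, and for $1\le i\le k$ let $Q_i^k=\partial P_k/\partial X_{k-i}$. Each $Q_i^k$ ($k\ge i$) is a polynomial in $X_0,\dots,X_{i-1}$ only, and $Q_i^k(v)$ denotes its evaluation at $(X_0,\dots,X_{i-1})=v$. *)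

theory Defs
  imports "HOL-Analysis.Analysis" "HOL-Library.Poly_Mapping"
begin

text \<open>Polynomials in commuting scalar indeterminates X_0, X_1, ... with coefficients in
  End(R^n) (n x n real matrices, product written **). A monomial is a finitely supported
  exponent vector (a finitely supported map nat to nat); a polynomial is its coefficient function.
  All polynomials arising below have finitely many nonzero coefficients.\<close>

type_synonym monom = "nat \<Rightarrow>\<^sub>0 nat"
type_synonym 'n mpoly_mat = "monom \<Rightarrow> real^'n^'n"

text \<open>P involves only X_0,...,X_(l-1).\<close>
definition involves_only :: "('n::finite) mpoly_mat \<Rightarrow> nat \<Rightarrow> bool" where
  "involves_only P l \<longleftrightarrow> (\<forall>m. P m \<noteq> 0 \<longrightarrow> (\<forall>j\<ge>l. Poly_Mapping.lookup m j = 0))"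

text \<open>The least l such that P involves only X_0,...,X_(l-1).\<close>
definition nvars :: "('n::finite) mpoly_mat \<Rightarrow> nat" where
  "nvars P = (LEAST l. involves_only P l)"

text \<open>Formal partial derivative with respect to X_j.\<close>
definition pderiv_mp :: "nat \<Rightarrow> ('n::finite) mpoly_mat \<Rightarrow> ('n::finite) mpoly_mat" where
  "pderiv_mp j P = (\<lambda>m. real (Poly_Mapping.lookup m j + 1) *\<^sub>R P (m + Poly_Mapping.single j 1))"

text \<open>Multiplication by the indeterminate X_j.\<close>
definition mulX :: "nat \<Rightarrow> ('n::finite) mpoly_mat \<Rightarrow> ('n::finite) mpoly_mat" where
  "mulX j P = (\<lambda>m. if 1 \<le> Poly_Mapping.lookup m j then P (m - Poly_Mapping.single j 1) else 0)"

text \<open>Right multiplication of every coefficient by a matrix M.\<close>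
definition rmul :: "('n::finite) mpoly_mat \<Rightarrow> real^'n^'n \<Rightarrow> ('n::finite) mpoly_mat" where
  "rmul P M = (\<lambda>m. P m ** M)"

text \<open>Psi(P) = P (A + X_0 B) + sum_(i<k) dP/dX_i X_(i+1), k = nvars P.\<close>
definition Psi :: "real^('n::finite)^'n \<Rightarrow> real^'n^'n \<Rightarrow> ('n::finite) mpoly_mat \<Rightarrow> ('n::finite) mpoly_mat" where
  "Psi A B P = (\<lambda>m. rmul P A m + mulX 0 (rmul P B) m
                    + (\<Sum>i<nvars P. mulX (Suc i) (pderiv_mp i P) m))"

text \<open>The constant polynomial I.\<close>
definition one_mp :: "('n::finite) mpoly_mat" where
  "one_mp = (\<lambda>m. if m = 0 then mat 1 else 0)"

text \<open>P_0 = I, P_(k+1) = Psi(P_k).\<close>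
primrec Pseq :: "real^('n::finite)^'n \<Rightarrow> real^'n^'n \<Rightarrow> nat \<Rightarrow> ('n::finite) mpoly_mat" where
  "Pseq A B 0 = one_mp"
| "Pseq A B (Suc k) = Psi A B (Pseq A B k)"

text \<open>Q_i^k = dP_k/dX_(k-i).\<close>
definition Qpoly :: "real^('n::finite)^'n \<Rightarrow> real^'n^'n \<Rightarrow> nat \<Rightarrow> nat \<Rightarrow> ('n::finite) mpoly_mat" where
  "Qpoly A B i k = pderiv_mp (k - i) (Pseq A B k)"

text \<open>Evaluation of a (finitely supported) polynomial at a point x : nat \<Rightarrow> real.\<close>
definition eval_mp :: "('n::finite) mpoly_mat \<Rightarrow> (nat \<Rightarrow> real) \<Rightarrow> real^'n^'n" where
  "eval_mp P x = (\<Sum>m\<in>{m. P m \<noteq> 0}. (\<Prod>j\<in>Poly_Mapping.keys m. x j ^ Poly_Mapping.lookup m j) *\<^sub>R P m)"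

text \<open>Evaluation at (X_0,...,X_(i-1)) = v for v in R^i given as a list of length i.\<close>
definition eval_at_list :: "('n::finite) mpoly_mat \<Rightarrow> real list \<Rightarrow> real^'n^'n" where
  "eval_at_list P v = eval_mp P (\<lambda>j. if j < length v then v ! j else 0)"

end

theory Submission
  imports Defs "HOL-Library.Function_Algebras"
begin

(*
  Differentiating P_(k+1) = Psi(P_k) gives the recurrence
  Q_(i+1)^(k+1) = Q_(i+1)^k + Psi_i(Q_i^k), where Psi_i is Psi with the number of variables frozen
  at i, a linear operator independent of k. By induction on i, the i-th forward difference of
  k \<mapsto> Q_i^k vanishes for k \<ge> i. Evaluating at v and applying w \<mapsto> C (B^m (w \<omega>0)) is additive
  on finitely supported polynomials, so h k = C B^m Q_i^k(v) \<omega>0 also has vanishing i-th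
  differences from i on. Such a real sequence is a polynomial in k: it is eventually of constant
  nonzero sign unless it vanishes identically.
*)

section \<open>Formal derivatives and the operator Psi\<close>

lemma minus_single_add_single:
  "1 \<le> Poly_Mapping.lookup m j \<Longrightarrow> m - Poly_Mapping.single j 1 + Poly_Mapping.single j 1 = (m::monom)"
  by (rule poly_mapping_eqI) (auto simp: lookup_add lookup_minus lookup_single when_def)

lemma add_single_minus_single_commute:
  fixes m :: monom
  assumes "j \<noteq> l" "1 \<le> Poly_Mapping.lookup m l"
  shows "m + Poly_Mapping.single j 1 - Poly_Mapping.single l 1
       = m - Poly_Mapping.single l 1 + Poly_Mapping.single j 1"
  using assms by (intro poly_mapping_eqI) (auto simp: lookup_add lookup_minus lookup_single when_def)

lemma matrix_diff_rdistrib: "(X - Y) ** M = X ** M - Y ** (M::real^'n^'n)"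
  by (vector matrix_matrix_mult_def sum_subtractf left_diff_distrib)

lemma pderiv_mp_mulX_other:
  assumes "j \<noteq> l"
  shows "pderiv_mp j (mulX l P) = mulX l (pderiv_mp j P)"
proof
  fix m :: monom
  show "pderiv_mp j (mulX l P) m = mulX l (pderiv_mp j P) m"
    using assms add_single_minus_single_commute[OF assms, of m]
    by (cases "1 \<le> Poly_Mapping.lookup m l")
      (simp_all add: pderiv_mp_def mulX_def lookup_add lookup_minus lookup_single)
qed

lemma pderiv_mp_mulX_same: "pderiv_mp j (mulX j P) = mulX j (pderiv_mp j P) + P"
proof
  fix m :: monom
  show "pderiv_mp j (mulX j P) m = (mulX j (pderiv_mp j P) + P) m"
  proof (cases "Poly_Mapping.lookup m j")
    case 0
    then show ?thesis by (simp add: pderiv_mp_def mulX_def lookup_add)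
  next
    case (Suc e)
    then have "m - Poly_Mapping.single j 1 + Poly_Mapping.single j 1 = m"
      by (intro minus_single_add_single) simp
    with Suc show ?thesis
      by (simp add: pderiv_mp_def mulX_def lookup_add lookup_minus algebra_simps)
  qed
qed

lemma sum_fun_apply: "(\<Sum>l\<in>S. F l) x = (\<Sum>l\<in>S. F l x)"
  by (induction S rule: infinite_finite_induct) simp_all

lemma mulX_0: "mulX j 0 = 0"
  by (simp add: mulX_def fun_eq_iff)

lemma pderiv_mp_rmul: "pderiv_mp j (rmul P M) = rmul (pderiv_mp j P) M"
  by (simp add: pderiv_mp_def rmul_def scalar_matrix_assoc fun_eq_iff)

lemma pderiv_mp_commute: "pderiv_mp j (pderiv_mp l P) = pderiv_mp l (pderiv_mp j P)"
  by (simp add: pderiv_mp_def lookup_add lookup_single when_def ac_simps fun_eq_iff)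

lemma pderiv_mp_add: "pderiv_mp j (P + Q) = pderiv_mp j P + pderiv_mp j Q"
  by (simp add: pderiv_mp_def scaleR_right_distrib fun_eq_iff)

lemma pderiv_mp_diff: "pderiv_mp j (P - Q) = pderiv_mp j P - pderiv_mp j Q"
  by (simp add: pderiv_mp_def scaleR_right_diff_distrib fun_eq_iff)

lemma pderiv_mp_sum: "pderiv_mp j (\<Sum>l\<in>S. F l) = (\<Sum>l\<in>S. pderiv_mp j (F l))"
  by (simp add: pderiv_mp_def scaleR_sum_right sum_fun_apply fun_eq_iff)

lemma mulX_diff: "mulX j (P - Q) = mulX j P - mulX j Q"
  by (simp add: mulX_def fun_eq_iff)

lemma rmul_diff: "rmul (P - Q) M = rmul P M - rmul Q M"
  by (simp add: rmul_def matrix_diff_rdistrib fun_eq_iff)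

text \<open>Psi with the number of variables fixed to N rather than nvars P; unlike Psi it is additive.\<close>

definition Psi_vars :: "real^('n::finite)^'n \<Rightarrow> real^'n^'n \<Rightarrow> nat \<Rightarrow> 'n mpoly_mat \<Rightarrow> 'n mpoly_mat" where
  "Psi_vars A B N P = rmul P A + mulX 0 (rmul P B) + (\<Sum>l<N. mulX (Suc l) (pderiv_mp l P))"

lemma Psi_vars_diff: "Psi_vars A B N (P - Q) = Psi_vars A B N P - Psi_vars A B N Q"
  by (simp add: Psi_vars_def rmul_diff mulX_diff pderiv_mp_diff sum_subtractf)

lemma Psi_vars_0: "Psi_vars A B N 0 = 0"
  using Psi_vars_diff[of A B N 0 0] by simp

lemma pderiv_mp_Psi_vars:
  assumes "j < N"
  shows "pderiv_mp (Suc j) (Psi_vars A B N P) = Psi_vars A B N (pderiv_mp (Suc j) P) + pderiv_mp j P"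
proof -
  have "pderiv_mp (Suc j) (mulX (Suc l) (pderiv_mp l P))
      = mulX (Suc l) (pderiv_mp l (pderiv_mp (Suc j) P)) + (if l = j then pderiv_mp j P else 0)" for l
    by (cases "l = j") (simp_all add: pderiv_mp_mulX_same pderiv_mp_mulX_other pderiv_mp_commute)
  then have "pderiv_mp (Suc j) (\<Sum>l<N. mulX (Suc l) (pderiv_mp l P))
      = (\<Sum>l<N. mulX (Suc l) (pderiv_mp l (pderiv_mp (Suc j) P))) + pderiv_mp j P"
    using assms by (simp add: pderiv_mp_sum sum.distrib)
  then show ?thesis
    by (simp add: Psi_vars_def pderiv_mp_add pderiv_mp_rmul pderiv_mp_mulX_other)
qed

section \<open>Variables involved and the recurrence for Q\<close>

lemma involves_only_mono: "involves_only P M \<Longrightarrow> M \<le> N \<Longrightarrow> involves_only P N"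
  unfolding involves_only_def by auto

lemma involves_only_0: "involves_only 0 N"
  unfolding involves_only_def by simp

lemma involves_only_add: "involves_only P N \<Longrightarrow> involves_only Q N \<Longrightarrow> involves_only (P + Q) N"
  unfolding involves_only_def by (metis add.right_neutral plus_fun_apply)

lemma involves_only_sum:
  "(\<And>l. l \<in> S \<Longrightarrow> involves_only (F l) N) \<Longrightarrow> involves_only (\<Sum>l\<in>S. F l) N"
  by (induction S rule: infinite_finite_induct) (simp_all add: involves_only_0 involves_only_add)

lemma involves_only_pderiv_mp: "involves_only P N \<Longrightarrow> involves_only (pderiv_mp j P) N"
  unfolding involves_only_def pderiv_mp_def by (auto simp: lookup_add)

lemma involves_only_rmul: "involves_only P N \<Longrightarrow> involves_only (rmul P M) N"
  unfolding involves_only_def rmul_def by (metis Finite_Cartesian_Product.times0_left)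

lemma involves_only_mulX: "involves_only P N \<Longrightarrow> l < N \<Longrightarrow> involves_only (mulX l P) N"
  unfolding involves_only_def mulX_def by (auto simp: lookup_minus lookup_single when_def)

lemma pderiv_mp_eq_0_if_involves_only:
  assumes "involves_only P N" "N \<le> l"
  shows "pderiv_mp l P = 0"
proof
  fix m :: monom
  have "P (m + Poly_Mapping.single l 1) = 0"
    using assms unfolding involves_only_def by (fastforce simp: lookup_add)
  then show "pderiv_mp l P m = 0 m" by (simp add: pderiv_mp_def)
qed

lemma involves_only_Psi_vars:
  assumes "involves_only P N"
  shows "involves_only (Psi_vars A B N P) (Suc N)"
proof -
  have P: "involves_only P (Suc N)"
    using assms by (rule involves_only_mono) simp
  show ?thesis
    unfolding Psi_vars_def
    by (intro involves_only_add involves_only_sum involves_only_rmul[OF P]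
        involves_only_mulX[OF involves_only_rmul[OF P]]
        involves_only_mulX[OF involves_only_pderiv_mp[OF P]]) auto
qed

lemma Psi_vars_cong:
  assumes "involves_only P M" "M \<le> N"
  shows "Psi_vars A B N P = Psi_vars A B M P"
proof -
  have "(\<Sum>l<N. mulX (Suc l) (pderiv_mp l P)) = (\<Sum>l<M. mulX (Suc l) (pderiv_mp l P))"
    using assms pderiv_mp_eq_0_if_involves_only[OF assms(1)]
    by (intro sum.mono_neutral_right) (auto simp: mulX_0)
  then show ?thesis by (simp add: Psi_vars_def)
qed

lemma Psi_eq_Psi_vars:
  assumes "involves_only P N"
  shows "Psi A B P = Psi_vars A B N P"
proof -
  have "nvars P \<le> N" "involves_only P (nvars P)"
    using assms unfolding nvars_def by (auto intro: Least_le LeastI)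
  then have "Psi_vars A B N P = Psi_vars A B (nvars P) P"
    by (intro Psi_vars_cong)
  also have "\<dots> = Psi A B P"
    by (simp add: Psi_def Psi_vars_def fun_eq_iff sum_fun_apply)
  finally show ?thesis ..
qed

lemma involves_only_Pseq: "involves_only (Pseq A B k) k"
proof (induction k)
  case 0
  show ?case by (simp add: involves_only_def one_mp_def)
next
  case (Suc k)
  then show ?case by (simp add: Psi_eq_Psi_vars involves_only_Psi_vars)
qed

lemma Pseq_Suc_Psi_vars: "Pseq A B (Suc k) = Psi_vars A B k (Pseq A B k)"
  by (simp add: Psi_eq_Psi_vars[OF involves_only_Pseq])

lemma Qpoly_0: "Qpoly A B 0 k = 0"
  unfolding Qpoly_def by (rule pderiv_mp_eq_0_if_involves_only[OF involves_only_Pseq]) simp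

lemma Qpoly_Suc:
  assumes "Suc i \<le> k"
  shows "Qpoly A B (Suc i) (Suc k) = Psi_vars A B k (Qpoly A B i k) + Qpoly A B (Suc i) k"
proof -
  have "Suc k - Suc i = Suc (k - Suc i)" "k - i = Suc (k - Suc i)" "k - Suc i < k"
    using assms by auto
  then show ?thesis
    by (simp only: Qpoly_def Pseq_Suc_Psi_vars pderiv_mp_Psi_vars)
qed

lemma involves_only_Qpoly: "i \<le> k \<Longrightarrow> involves_only (Qpoly A B i k) i"
proof (induction i arbitrary: k)
  case 0
  show ?case unfolding Qpoly_0 by (rule involves_only_0)
next
  case (Suc i)
  from Suc.prems show ?case
  proof (induction k rule: dec_induct)
    case base
    show ?case
      unfolding Qpoly_def diff_self_eq_0 by (rule involves_only_pderiv_mp[OF involves_only_Pseq])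
  next
    case (step k)
    have Qi: "involves_only (Qpoly A B i k) i"
      using Suc.IH step.hyps by simp
    then have "Psi_vars A B k (Qpoly A B i k) = Psi_vars A B i (Qpoly A B i k)"
      using step.hyps by (intro Psi_vars_cong) simp_all
    then show ?case
      unfolding Qpoly_Suc[OF step.hyps(1)]
      by (simp only:) (intro involves_only_add involves_only_Psi_vars Qi step.IH)
  qed
qed

lemma Qpoly_Suc_diff:
  assumes "Suc i \<le> k"
  shows "Qpoly A B (Suc i) (Suc k) - Qpoly A B (Suc i) k = Psi_vars A B i (Qpoly A B i k)"
proof -
  have "Psi_vars A B k (Qpoly A B i k) = Psi_vars A B i (Qpoly A B i k)"
    using assms by (intro Psi_vars_cong involves_only_Qpoly) simp_all
  with assms show ?thesis by (simp add: Qpoly_Suc)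
qed

section \<open>Iterated forward differences\<close>

fun fwd_diff :: "nat \<Rightarrow> (nat \<Rightarrow> 'a::ab_group_add) \<Rightarrow> nat \<Rightarrow> 'a" where
  "fwd_diff 0 f = f"
| "fwd_diff (Suc d) f = fwd_diff d (\<lambda>k. f (Suc k) - f k)"

lemma fwd_diff_cong:
  "(\<And>j. k0 \<le> j \<Longrightarrow> f j = g j) \<Longrightarrow> k0 \<le> k \<Longrightarrow> fwd_diff d f k = fwd_diff d g k"
proof (induction d arbitrary: f g k)
  case (Suc d)
  have "fwd_diff d (\<lambda>j. f (Suc j) - f j) k = fwd_diff d (\<lambda>j. g (Suc j) - g j) k"
    using Suc.prems by (intro Suc.IH) simp_all
  then show ?case by simp
qed simp

lemma fwd_diff_additive:
  assumes "\<And>a b. a \<in> S \<Longrightarrow> b \<in> S \<Longrightarrow> a - b \<in> S"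
    and "\<And>a b. a \<in> S \<Longrightarrow> b \<in> S \<Longrightarrow> F (a - b) = F a - F b"
    and "\<And>k. f k \<in> S"
  shows "fwd_diff d (\<lambda>k. F (f k)) k = F (fwd_diff d f k)"
  using assms(3)
proof (induction d arbitrary: f k)
  case (Suc d)
  have "(\<lambda>k. F (f (Suc k)) - F (f k)) = (\<lambda>k. F (f (Suc k) - f k))"
    using assms(2) Suc.prems by simp
  then show ?case
    using Suc.IH[of "\<lambda>k. f (Suc k) - f k"] assms(1) Suc.prems by simp
qed simp

lemma fwd_diff_Qpoly_eq_0: "i \<le> k \<Longrightarrow> fwd_diff i (Qpoly A B i) k = 0"
proof (induction i arbitrary: k)
  case 0
  then show ?case by (simp add: Qpoly_0)
next
  case (Suc i)
  have "fwd_diff (Suc i) (Qpoly A B (Suc i)) k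
      = fwd_diff i (\<lambda>k. Qpoly A B (Suc i) (Suc k) - Qpoly A B (Suc i) k) k"
    by simp
  also have "\<dots> = fwd_diff i (\<lambda>k. Psi_vars A B i (Qpoly A B i k)) k"
    using Suc.prems by (intro fwd_diff_cong[of "Suc i"]) (simp_all add: Qpoly_Suc_diff)
  also have "\<dots> = Psi_vars A B i (fwd_diff i (Qpoly A B i) k)"
    using fwd_diff_additive[of UNIV "Psi_vars A B i" "Qpoly A B i"] by (simp add: Psi_vars_diff)
  also have "\<dots> = 0"
    using Suc by (metis Psi_vars_0 Suc_leD)
  finally show ?case .
qed

section \<open>Evaluation\<close>

text \<open>eval_mp sums over the support, so it is additive only on finitely supported polynomials.\<close>

definition finite_support_mp :: "('n::finite) mpoly_mat \<Rightarrow> bool" where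
  "finite_support_mp P \<longleftrightarrow> finite {m. P m \<noteq> 0}"

lemma finite_support_pderiv_mp:
  assumes "finite_support_mp P"
  shows "finite_support_mp (pderiv_mp j P)"
proof -
  have "{m. pderiv_mp j P m \<noteq> 0} \<subseteq> (\<lambda>m. m + Poly_Mapping.single j 1) -` {m. P m \<noteq> 0}"
    by (auto simp: pderiv_mp_def)
  moreover have "inj (\<lambda>m::monom. m + Poly_Mapping.single j 1)"
    by (simp add: inj_def)
  ultimately show ?thesis
    using assms unfolding finite_support_mp_def by (meson finite_subset finite_vimageI)
qed

lemma finite_support_mulX:
  assumes "finite_support_mp P"
  shows "finite_support_mp (mulX j P)"
proof -
  have "{m. mulX j P m \<noteq> 0} \<subseteq> (\<lambda>m. m + Poly_Mapping.single j 1) ` {m. P m \<noteq> 0}"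
  proof
    fix m assume "m \<in> {m. mulX j P m \<noteq> 0}"
    then have "P (m - Poly_Mapping.single j 1) \<noteq> 0" "1 \<le> Poly_Mapping.lookup m j"
      by (auto simp: mulX_def split: if_splits)
    then show "m \<in> (\<lambda>m. m + Poly_Mapping.single j 1) ` {m. P m \<noteq> 0}"
      by (metis (mono_tags, lifting) image_eqI mem_Collect_eq minus_single_add_single)
  qed
  then show ?thesis
    using assms unfolding finite_support_mp_def by (meson finite_subset finite_imageI)
qed

lemma finite_support_rmul: "finite_support_mp P \<Longrightarrow> finite_support_mp (rmul P M)"
  unfolding finite_support_mp_def rmul_def by (rule finite_subset[rotated]) auto

lemma finite_support_add:
  "finite_support_mp P \<Longrightarrow> finite_support_mp Q \<Longrightarrow> finite_support_mp (P + Q)"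
  unfolding finite_support_mp_def
  by (rule finite_subset[of _ "{m. P m \<noteq> 0} \<union> {m. Q m \<noteq> 0}"]) auto

lemma finite_support_diff:
  "finite_support_mp P \<Longrightarrow> finite_support_mp Q \<Longrightarrow> finite_support_mp (P - Q)"
  unfolding finite_support_mp_def
  by (rule finite_subset[of _ "{m. P m \<noteq> 0} \<union> {m. Q m \<noteq> 0}"]) auto

lemma finite_support_sum:
  "(\<And>l. l \<in> S \<Longrightarrow> finite_support_mp (F l)) \<Longrightarrow> finite_support_mp (\<Sum>l\<in>S. F l)"
  by (induction S rule: infinite_finite_induct)
    (simp_all add: finite_support_add, simp_all add: finite_support_mp_def)

lemma finite_support_Psi_vars: "finite_support_mp P \<Longrightarrow> finite_support_mp (Psi_vars A B N P)"
  unfolding Psi_vars_def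
  by (intro finite_support_add finite_support_sum finite_support_rmul finite_support_mulX
      finite_support_pderiv_mp)

lemma finite_support_Qpoly: "finite_support_mp (Qpoly A B i k)"
proof -
  have "finite_support_mp (Pseq A B k)"
  proof (induction k)
    case 0
    show ?case by (simp add: finite_support_mp_def one_mp_def)
  next
    case (Suc k)
    then show ?case unfolding Pseq_Suc_Psi_vars by (rule finite_support_Psi_vars)
  qed
  then show ?thesis
    unfolding Qpoly_def by (rule finite_support_pderiv_mp)
qed

lemma eval_mp_eq_sum_superset:
  assumes "finite S" "{m. P m \<noteq> 0} \<subseteq> S"
  shows "eval_mp P x = (\<Sum>m\<in>S. (\<Prod>j\<in>Poly_Mapping.keys m. x j ^ Poly_Mapping.lookup m j) *\<^sub>R P m)"
  unfolding eval_mp_def by (rule sum.mono_neutral_left) (use assms in auto)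

lemma eval_mp_diff:
  assumes "finite_support_mp P" "finite_support_mp Q"
  shows "eval_mp (P - Q) x = eval_mp P x - eval_mp Q x"
proof -
  let ?S = "{m. P m \<noteq> 0} \<union> {m. Q m \<noteq> 0}"
  have "finite ?S" "{m. (P - Q) m \<noteq> 0} \<subseteq> ?S"
    using assms by (auto simp: finite_support_mp_def)
  then show ?thesis
    using eval_mp_eq_sum_superset[of ?S P x] eval_mp_eq_sum_superset[of ?S Q x]
      eval_mp_eq_sum_superset[of ?S "P - Q" x]
    by (simp add: scaleR_right_diff_distrib sum_subtractf)
qed

lemma eval_mp_0: "eval_mp 0 x = 0"
  by (simp add: eval_mp_def)

lemma linear_funpow:
  fixes f :: "'a::real_vector \<Rightarrow> 'a"
  shows "linear f \<Longrightarrow> linear (f ^^ m)"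
  by (induction m) (simp_all add: linear_id linear_compose)

section \<open>Real sequences with vanishing differences\<close>

lemma eventually_sign_if_eventually_increasing:
  fixes h :: "nat \<Rightarrow> real"
  assumes "\<forall>\<^sub>F k in sequentially. h k < h (Suc k)"
  shows "(\<forall>\<^sub>F k in sequentially. h k > 0) \<or> (\<forall>\<^sub>F k in sequentially. h k < 0)"
proof -
  obtain k0 where inc: "\<And>k. k0 \<le> k \<Longrightarrow> h k < h (Suc k)"
    using assms by (auto simp: eventually_sequentially)
  have mono: "h j \<le> h k" if "k0 \<le> j" "j \<le> k" for j k
    using that(2)
  proof (induction k rule: dec_induct)
    case (step n)
    then show ?case using inc[of n] that(1) by simp
  qed simp
  show ?thesis
  proof (cases "\<exists>j\<ge>k0. h j > 0")
    case True
    then obtain j where "k0 \<le> j" "h j > 0" by blast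
    then have "\<forall>k\<ge>j. h k > 0" using mono by (meson less_le_trans)
    then show ?thesis by (auto simp: eventually_sequentially)
  next
    case False
    then have "\<forall>k\<ge>k0. h k < 0" using inc by (meson le_SucI not_less less_le_trans)
    then show ?thesis by (auto simp: eventually_sequentially)
  qed
qed

lemma fwd_diff_eq_0_imp_sign_cases:
  fixes h :: "nat \<Rightarrow> real"
  assumes "\<And>k. i \<le> k \<Longrightarrow> fwd_diff d h k = 0"
  shows "(\<forall>\<^sub>F k in sequentially. h k > 0) \<or> (\<forall>\<^sub>F k in sequentially. h k < 0) \<or> (\<forall>k\<ge>i. h k = 0)"
  using assms
proof (induction d arbitrary: h)
  case 0
  then show ?case by simp
next
  case (Suc d)
  have "\<And>k. i \<le> k \<Longrightarrow> fwd_diff d (\<lambda>k. h (Suc k) - h k) k = 0"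
    using Suc.prems by simp
  from Suc.IH[OF this] consider
      "\<forall>\<^sub>F k in sequentially. h k < h (Suc k)"
    | "\<forall>\<^sub>F k in sequentially. - h k < - h (Suc k)"
    | "\<forall>k\<ge>i. h (Suc k) = h k"
    by (force elim: eventually_mono)
  then show ?case
  proof cases
    case 1
    then show ?thesis using eventually_sign_if_eventually_increasing by blast
  next
    case 2
    from eventually_sign_if_eventually_increasing[OF this] show ?thesis by auto
  next
    case 3
    have "h k = h i" if "i \<le> k" for k
      using that by (induction k rule: dec_induct) (use 3 in auto)
    then have "(\<forall>k\<ge>i. h k > 0) \<or> (\<forall>k\<ge>i. h k < 0) \<or> (\<forall>k\<ge>i. h k = 0)"
      by (metis linorder_neqE_linordered_idom)
    then show ?thesis by (auto simp: eventually_sequentially)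
  qed
qed

theorem corollary3:
  fixes A B :: "real^'n^'n" and C :: "real^'n \<Rightarrow> real"
    and i m :: nat and v :: "real list" and \<omega>0 :: "real^'n"
  assumes "linear C" and "i \<ge> 1" and "length v = i"
  shows "(\<exists>k0\<ge>i. \<forall>k\<ge>k0. C ((((*v) B) ^^ m) (eval_at_list (Qpoly A B i k) v *v \<omega>0)) \<noteq> 0)
       \<or> (\<forall>k\<ge>i. C ((((*v) B) ^^ m) (eval_at_list (Qpoly A B i k) v *v \<omega>0)) = 0)"
proof -
  define F where "F P = C ((((*v) B) ^^ m) (eval_at_list P v *v \<omega>0))" for P :: "'n mpoly_mat"
  have lin: "linear (\<lambda>x. C ((((*v) B) ^^ m) x))"
    using linear_compose[OF linear_funpow assms(1)] by (simp add: o_def)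
  have F_diff: "F (P - Q) = F P - F Q" if "finite_support_mp P" "finite_support_mp Q" for P Q
    using linear_diff[OF lin]
    by (simp add: F_def eval_at_list_def eval_mp_diff[OF that] matrix_vector_mult_diff_rdistrib)
  have F_0: "F 0 = 0"
    using linear_0[OF lin] by (simp add: F_def eval_at_list_def eval_mp_0)
  have fwd_diff_F: "fwd_diff i (\<lambda>k. F (Qpoly A B i k)) k = 0" if "i \<le> k" for k
  proof -
    have "fwd_diff i (\<lambda>k. F (Qpoly A B i k)) k = F (fwd_diff i (Qpoly A B i) k)"
      using fwd_diff_additive[of "Collect finite_support_mp" F "Qpoly A B i"]
        finite_support_diff F_diff finite_support_Qpoly by blast
    also have "\<dots> = 0"
      by (simp only: fwd_diff_Qpoly_eq_0[OF that] F_0)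
    finally show ?thesis .
  qed
  from fwd_diff_eq_0_imp_sign_cases[of i i "\<lambda>k. F (Qpoly A B i k)", OF fwd_diff_F]
  have "(\<forall>\<^sub>F k in sequentially. F (Qpoly A B i k) \<noteq> 0) \<or> (\<forall>k\<ge>i. F (Qpoly A B i k) = 0)"
    by (metis (mono_tags, lifting) eventually_mono less_irrefl)
  then show ?thesis
    unfolding F_def eventually_sequentially by (metis max.cobounded2 max.boundedE)
qed

end
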